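(* Let $G=(V,E)$ be a simple connected graph with $V=\{1,\dots,n\}$, adjacency matrix $A\in\mathbb{R}^{n\times n}$ and degree matrix $D$. Let $\mu\in(0,1]$, let $$Z=\begin{bmatrix} O & I\\ \mu(\mu I-D) & A\end{bmatrix}\in\mathbb{R}^{2n\times 2n},$$ and let $\{c_k\}_{k\ge 0}$ be a real sequence that is monotonically non-increasing for $k\ge1$ and such that $\sum_{k=0}^\infty c_kZ^k$ converges. Assume that, for $s=0,1$, the function $f_s(x)=\sum_{k=0}^\infty c_{s+k}x^k$ is defined on the spectrum of $Z$. Let $\phi(A,\mathbf{c})=\sum_{k=0}^\infty c_k q_k(A)$, where $q_k(A)$ are the backtrack-downweighted walk count matrices of $G$ with parameter $\mu$, and let $$\mathbb{L}_\mu(\mathbf{c})=\operatorname{diag}\big(\phi(A,\mathbf{c})\mathbf{1}\big)-\phi(A,\mathbf{c})$$ be the backtrack-downweighted $k$-walk transformed Laplacian. Then: \begin{itemize} \item $\mathbb{L}_\mu(\mathbf{c})$ is symmetric; \item $\mathbb{L}_\mu(\mathbf{c})\mathbf{1}=\mathbf{0}$; and \item if $\phi(A,\mathbf{c})\ge 0$ entrywise, then $\mathbb{L}_\mu(\mathbf{c})$ is an M-matrix. \end{itemize}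
   Context: A simple graph is a finite, unweighted, undirected graph with no loops and no repeated edges; its adjacency matrix $A$ has $A_{ij}=1$ if $(i,j)\in E$ and $0$ otherwise. The degree matrix $D$ is the diagonal matrix with $D_{ii}=(A\mathbf{1})_i$. Connected means that any two nodes are joined by a walk. $I,O\in\mathbb{R}^{n\times n}$ are the identity and zero matrices; $\mathbf{1},\mathbf{0}\in\mathbb{R}^n$ are the column vectors of all ones and all zeros. For a vector $\mathbf{v}$, $\operatorname{diag}(\mathbf{v})$ is the diagonal matrix with diagonal $\mathbf{v}$. Backtrack-downweighted walk count matrices: for $\mu\in[0,1]$ and $k\ge 0$, $(q_k(A))_{ij}$ is the weighted number of walks $i=i_0,i_1,\dots,i_k=j$ of length $k$ in $G$ (consecutive nodes adjacent), where each walk has weight $(1-\mu)^b$, with $b$ the number of indices $\ell$ such that $i_\ell=i_{\ell+2}$ (and $0^0=1$). It is known that these matrices are determined by $q_0(A)=I$, $q_1(A)=A$, $q_2(A)=A^2-\mu D$ and $$q_{k+1}(A)=A\,q_k(A)+\mu(\mu I-D)\,q_{k-1}(A),\qquad k\ge 2.$$ Each $q_k(A)$ is symmetric, since reversing a walk preserves its weight. "$f_s$ is defined on the spectrum of $Z$" has the standard meaning from the theory of matrix functions: for every eigenvalue $\lambda$ of $Z$, $f_s(\lambda)$ and the derivatives $f_s^{(j)}(\lambda)$, for $j$ up to one less than the size of the largest Jordan block of $\lambda$, exist. A matrix $M\in\mathbb{R}^{n\times n}$ is a $Z$-matrix if $M_{ij}\le 0$ for all $i\ne j$. It is an M-matrix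 if it is a $Z$-matrix and every eigenvalue $\lambda$ of $M$ satisfies $\operatorname{Re}(\lambda)\ge 0$ (so singular M-matrices are allowed). *)

theory Defs
  imports "Jordan_Normal_Form.Spectral_Radius"
begin

section \<open>Graphs and walks\<close>

text \<open>The nodes are \<open>0, \<dots>, n - 1\<close>, matching the indexing of matrices; an undirected edge
  is represented by both of its orientations.\<close>

definition simple_graph :: "nat \<Rightarrow> (nat \<times> nat) set \<Rightarrow> bool" where
  "simple_graph n E \<longleftrightarrow> E \<subseteq> {..<n} \<times> {..<n} \<and> sym E \<and> irrefl E"

text \<open>A walk of length \<open>k\<close> is given by its \<open>k + 1\<close> nodes.\<close>

definition walks :: "(nat \<times> nat) set \<Rightarrow> nat \<Rightarrow> nat \<Rightarrow> nat \<Rightarrow> nat list set" where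
  "walks E k i j =
     {w. length w = k + 1 \<and> hd w = i \<and> last w = j \<and> (\<forall>l<k. (w ! l, w ! (l + 1)) \<in> E)}"

definition connected_graph :: "nat \<Rightarrow> (nat \<times> nat) set \<Rightarrow> bool" where
  "connected_graph n E \<longleftrightarrow> (\<forall>i<n. \<forall>j<n. \<exists>k. walks E k i j \<noteq> {})"

definition ones :: "nat \<Rightarrow> real vec" where
  "ones n = vec n (\<lambda>_. 1)"

definition diag :: "'a::zero vec \<Rightarrow> 'a mat" where
  "diag v = mat_diag (dim_vec v) (\<lambda>i. v $ i)"

definition adjacency_mat :: "nat \<Rightarrow> (nat \<times> nat) set \<Rightarrow> real mat" where
  "adjacency_mat n E = mat n n (\<lambda>(i, j). if (i, j) \<in> E then 1 else 0)"

definition degree_mat :: "nat \<Rightarrow> (nat \<times> nat) set \<Rightarrow> real mat" where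
  "degree_mat n E = diag (adjacency_mat n E *\<^sub>v ones n)"

definition backtracks :: "nat list \<Rightarrow> nat" where
  "backtracks w = card {l. l + 2 < length w \<and> w ! l = w ! (l + 2)}"

definition bd_walk_mat :: "nat \<Rightarrow> (nat \<times> nat) set \<Rightarrow> real \<Rightarrow> nat \<Rightarrow> real mat" where
  "bd_walk_mat n E \<mu> k = mat n n (\<lambda>(i, j). \<Sum>w\<in>walks E k i j. (1 - \<mu>) ^ backtracks w)"

section \<open>Series of matrices\<close>

definition mat_summable :: "nat \<Rightarrow> (nat \<Rightarrow> real mat) \<Rightarrow> bool" where
  "mat_summable n F \<longleftrightarrow> (\<forall>i<n. \<forall>j<n. summable (\<lambda>k. F k $$ (i, j)))"

definition mat_suminf :: "nat \<Rightarrow> (nat \<Rightarrow> real mat) \<Rightarrow> real mat" where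
  "mat_suminf n F = mat n n (\<lambda>(i, j). \<Sum>k. F k $$ (i, j))"

section \<open>Functions defined on the spectrum of a matrix\<close>

text \<open>The function given by a power series is a partial function, whose domain is the set of
  all points of convergence. The derivative of a partial function is again partial: it is
  defined at the points of the domain where the difference quotient has a limit within the
  domain. On the open disc of convergence this is the ordinary complex derivative; at points
  of convergence on the boundary circle it is the derivative relative to the domain.\<close>

definition power_series_fun :: "(nat \<Rightarrow> complex) \<Rightarrow> (complex \<rightharpoonup> complex)" where
  "power_series_fun a x =
     (if summable (\<lambda>k. a k * x ^ k) then Some (\<Sum>k. a k * x ^ k) else None)"

definition partial_deriv :: "(complex \<rightharpoonup> complex) \<Rightarrow> (complex \<rightharpoonup> complex)" where
  "partial_deriv f x =
     (if x \<in> dom f \<and> at x within dom f \<noteq> bot \<and>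
         (\<exists>d. ((\<lambda>z. the (f z)) has_field_derivative d) (at x within dom f))
      then Some (THE d. ((\<lambda>z. the (f z)) has_field_derivative d) (at x within dom f))
      else None)"

definition largest_jordan_block :: "complex mat \<Rightarrow> complex \<Rightarrow> nat" where
  "largest_jordan_block M x = Max {m. \<exists>n_as. jordan_nf M n_as \<and> (m, x) \<in> set n_as}"

definition defined_on_spectrum :: "(complex \<rightharpoonup> complex) \<Rightarrow> complex mat \<Rightarrow> bool" where
  "defined_on_spectrum f M \<longleftrightarrow>
     (\<forall>x. eigenvalue M x \<longrightarrow>
        (\<forall>j\<le>largest_jordan_block M x - 1. x \<in> dom ((partial_deriv ^^ j) f)))"

lemma partial_deriv_on_open:
  assumes S: "open S" "x \<in> S" and f: "\<And>z. z \<in> S \<Longrightarrow> f z = Some (g z)"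
    and g: "(g has_field_derivative d) (at x)"
  shows "partial_deriv f x = Some d"
proof -
  have sub: "S \<subseteq> dom f" using f by auto
  have at: "at x within dom f = at x"
    using S sub by (metis at_within_open_subset)
  have "((\<lambda>z. the (f z)) has_field_derivative d) (at x)"
    using has_field_derivative_transform_within_open[OF g S, of "\<lambda>z. the (f z)"] f by simp
  moreover from this have "(THE d. ((\<lambda>z. the (f z)) has_field_derivative d) (at x)) = d"
    by (intro the_equality) (auto intro: DERIV_unique)
  ultimately show ?thesis
    using S sub unfolding partial_deriv_def at by auto
qed

lemma partial_deriv_power_series_fun:
  assumes r: "\<And>z. norm z < r \<Longrightarrow> summable (\<lambda>k. a k * z ^ k)" and x: "norm x < r"
  shows "(partial_deriv ^^ j) (power_series_fun a) x = power_series_fun ((diffs ^^ j) a) x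
    \<and> summable (\<lambda>k. (diffs ^^ j) a k * x ^ k)"
  using x
proof (induction j arbitrary: x)
  case 0
  then show ?case using r by simp
next
  case (Suc j)
  let ?b = "(diffs ^^ j) a"
  let ?S = "{z :: complex. norm z < r}"
  have op: "open ?S" by (intro open_Collect_less continuous_intros)
  have smm: "summable (\<lambda>k. ?b k * z ^ k)" if "norm z < r" for z
    using Suc.IH[OF that] by simp
  have "((\<lambda>z. \<Sum>k. ?b k * z ^ k) has_field_derivative (\<Sum>k. diffs ?b k * x ^ k)) (at x)"
    using termdiffs_strong'[of r ?b x] smm Suc.prems
    by auto
  from partial_deriv_on_open[OF op _ _ this, of "(partial_deriv ^^ j) (power_series_fun a)"]
  have "partial_deriv ((partial_deriv ^^ j) (power_series_fun a)) x
      = Some (\<Sum>k. diffs ?b k * x ^ k)"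
    using Suc.IH Suc.prems by (auto simp: power_series_fun_def)
  moreover have "summable (\<lambda>k. diffs ?b k * x ^ k)"
    using termdiff_converges[of x r ?b] smm Suc.prems by auto
  ultimately show ?case by (simp add: power_series_fun_def[of "diffs ?b"])
qed

section \<open>M-matrices\<close>

definition Z_matrix :: "real mat \<Rightarrow> bool" where
  "Z_matrix M \<longleftrightarrow> square_mat M \<and>
     (\<forall>i<dim_row M. \<forall>j<dim_col M. i \<noteq> j \<longrightarrow> M $$ (i, j) \<le> 0)"

definition M_matrix :: "real mat \<Rightarrow> bool" where
  "M_matrix M \<longleftrightarrow> Z_matrix M \<and>
     (\<forall>x. eigenvalue (map_mat complex_of_real M) x \<longrightarrow> 0 \<le> Re x)"

section \<open>The transformed Laplacian\<close>

definition bd_block_mat :: "nat \<Rightarrow> (nat \<times> nat) set \<Rightarrow> real \<Rightarrow> real mat" where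
  "bd_block_mat n E \<mu> =
     four_block_mat (0\<^sub>m n n) (1\<^sub>m n)
       (\<mu> \<cdot>\<^sub>m (\<mu> \<cdot>\<^sub>m 1\<^sub>m n - degree_mat n E)) (adjacency_mat n E)"

definition bd_phi :: "nat \<Rightarrow> (nat \<times> nat) set \<Rightarrow> real \<Rightarrow> (nat \<Rightarrow> real) \<Rightarrow> real mat" where
  "bd_phi n E \<mu> c = mat_suminf n (\<lambda>k. c k \<cdot>\<^sub>m bd_walk_mat n E \<mu> k)"

definition bd_laplacian :: "nat \<Rightarrow> (nat \<times> nat) set \<Rightarrow> real \<Rightarrow> (nat \<Rightarrow> real) \<Rightarrow> real mat" where
  "bd_laplacian n E \<mu> c = diag (bd_phi n E \<mu> c *\<^sub>v ones n) - bd_phi n E \<mu> c"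

end

theory Submission
  imports Defs
begin

text \<open>For \<open>k \<ge> 1\<close> the recurrence of the walk counts reads \<open>[q\<^sub>k; q\<^bsub>k+1\<^esub>] = Z\<^bsup>k-1\<^esup> [q\<^sub>1; q\<^sub>2]\<close>, where \<open>Z\<close> is the block
  matrix, so \<open>\<Sum>\<^sub>k c\<^sub>k q\<^sub>k\<close> converges if \<open>\<Sum>\<^sub>k c\<^sub>k Z\<^bsup>k-1\<^esup>\<close> does, and this follows from the convergence of
  \<open>\<Sum>\<^sub>k c\<^sub>k Z\<^sup>k\<close> even though \<open>Z\<close> may be singular. Symmetry comes from reversing walks, and the
  eigenvalues are located by Gershgorin's theorem applied to the zero row sums.\<close>

section \<open>Powers of a matrix\<close>

lemma pow_mat_add:
  fixes A :: "'a::comm_ring_1 mat"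
  assumes A: "A \<in> carrier_mat m m"
  shows "A ^\<^sub>m (k + l) = A ^\<^sub>m k * A ^\<^sub>m l"
proof (induction l)
  case 0
  then show ?case using A by (simp add: right_mult_one_mat[OF pow_carrier_mat[OF A]])
next
  case (Suc l)
  have "A ^\<^sub>m (k + Suc l) = (A ^\<^sub>m k * A ^\<^sub>m l) * A" using Suc by simp
  also have "\<dots> = A ^\<^sub>m k * (A ^\<^sub>m l * A)"
    using A by (intro assoc_mult_mat[of _ m m _ m _ m]) auto
  finally show ?case by simp
qed

lemma index_pow_mat_add:
  fixes A :: "'a::comm_ring_1 mat"
  assumes A: "A \<in> carrier_mat m m" and "i < m" "j < m"
  shows "(A ^\<^sub>m (k + l)) $$ (i, j) = (\<Sum>h<m. (A ^\<^sub>m k) $$ (i, h) * (A ^\<^sub>m l) $$ (h, j))"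
  unfolding pow_mat_add[OF A]
  using assms by (simp add: scalar_prod_def atLeast0LessThan)

text \<open>A dimension count: \<open>m * m + 1\<close> powers live in a space of dimension
  \<open>m * m\<close>. The index \<open>s\<close> records that the dependence is
  nontrivial.\<close>

lemma pow_mat_linear_dependence:
  fixes A :: "'a::field mat"
  assumes A: "A \<in> carrier_mat m m"
  obtains x N s where "s < N" "x s \<noteq> 0"
    "\<And>i j. i < m \<Longrightarrow> j < m \<Longrightarrow> (\<Sum>k<N. x k * (A ^\<^sub>m k) $$ (i, j)) = 0"
proof -
  \<comment> \<open>Column \<open>k\<close> of \<open>B\<close> is the \<open>k\<close>-th power
    flattened row by row. The extra row \<open>m * m\<close> of zeros makes \<open>B\<close> square,
    so that the determinant yields a kernel vector.\<close>
  define N where "N = Suc (m * m)"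
  define f where
    "f r k = (if r < m * m then (A ^\<^sub>m k) $$ (r div m, r mod m) else 0)" for r k
  define B where "B = mat N N (\<lambda>(r, k). f r k)"
  have B: "B \<in> carrier_mat N N" by (simp add: B_def)
  have zero_row: "row B (m * m) = 0\<^sub>v N"
    by (intro eq_vecI) (auto simp: B_def f_def N_def)
  have "det B = 0"
  proof -
    have "B = mat\<^sub>r N N (\<lambda>r. if r = m * m then 0\<^sub>v N else row B r)"
      using B zero_row by (intro eq_rowI) auto
    also have "det \<dots> = 0"
      using B by (intro det_row_0) (auto simp: N_def)
    finally show ?thesis .
  qed
  then obtain v where v: "v \<in> carrier_vec N" "v \<noteq> 0\<^sub>v N" "B *\<^sub>v v = 0\<^sub>v N"
    using det_0_iff_vec_prod_zero[OF B] by blast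
  obtain s where s: "s < N" "v $ s \<noteq> 0"
    using v(1,2) by (metis eq_vecI carrier_vecD index_zero_vec)
  show ?thesis
  proof (rule that[where s = s and N = N and x = "\<lambda>k. v $ k"])
    fix i j assume ij: "i < m" "j < m"
    let ?r = "i * m + j"
    \<comment> \<open>The flattened position of entry \<open>(i, j)\<close> stays clear of the
      padding row.\<close>
    have "?r < Suc i * m" using ij by simp
    also have "\<dots> \<le> m * m" using ij by (intro mult_le_mono1) simp
    finally have r: "?r < m * m" .
    have "(B *\<^sub>v v) $ ?r = 0" using v(3) r by (simp add: N_def)
    moreover have "(B *\<^sub>v v) $ ?r = (\<Sum>k<N. B $$ (?r, k) * v $ k)"
      using r v(1) B by (simp add: scalar_prod_def atLeast0LessThan N_def)
    moreover have "B $$ (?r, k) = (A ^\<^sub>m k) $$ (i, j)" if "k < N" for k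
      using that r ij by (simp add: B_def f_def N_def)
    ultimately show "(\<Sum>k<N. v $ k * (A ^\<^sub>m k) $$ (i, j)) = 0"
      by (simp add: mult.commute)
  qed (use s in auto)
qed

text \<open>Solve a linear dependence for its lowest power and multiply by
  \<open>A ^\<^sub>m k\<close>. The coefficients \<open>y\<close> serve all \<open>k\<close> and all
  entries at once; \<open>N = 0\<close> means that the \<open>s\<close>-th power of \<open>A\<close>
  vanishes.\<close>

lemma pow_mat_eq_sum_higher_powers:
  fixes A :: "'a::field mat"
  assumes A: "A \<in> carrier_mat m m"
  obtains y N s where
    "\<And>k i j. i < m \<Longrightarrow> j < m \<Longrightarrow>
       (A ^\<^sub>m (s + k)) $$ (i, j) = (\<Sum>t<N. y t * (A ^\<^sub>m (Suc (s + t) + k)) $$ (i, j))"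
proof -
  obtain x M s0 where x: "s0 < M" "x s0 \<noteq> 0"
    "\<And>i j. i < m \<Longrightarrow> j < m \<Longrightarrow> (\<Sum>k<M. x k * (A ^\<^sub>m k) $$ (i, j)) = 0"
    by (rule pow_mat_linear_dependence[OF A], rule that)
  \<comment> \<open>The lowest power that really occurs; all other powers in the dependence are then
    higher, and there are at most \<open>N\<close> of them.\<close>
  define s where "s = (LEAST s. x s \<noteq> 0)"
  have s: "x s \<noteq> 0" unfolding s_def using x(2) by (rule LeastI)
  have below_s: "x k = 0" if "k < s" for k
    using not_less_Least[OF that[unfolded s_def]] by simp
  have "s \<le> s0" unfolding s_def using x(2) by (rule Least_le)
  define N where "N = M - Suc s"
  have M: "M = Suc s + N" using \<open>s \<le> s0\<close> x(1) by (simp add: N_def)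
  define y where "y t = - x (Suc (s + t)) / x s" for t
  have base: "(A ^\<^sub>m s) $$ (i, j) = (\<Sum>t<N. y t * (A ^\<^sub>m Suc (s + t)) $$ (i, j))"
    if ij: "i < m" "j < m" for i j
  proof -
    let ?g = "\<lambda>k. x k * (A ^\<^sub>m k) $$ (i, j)"
    have "0 = (\<Sum>k<M. ?g k)" using x(3)[OF ij] by simp
    also have "\<dots> = (\<Sum>k<Suc s. ?g k) + (\<Sum>t<N. ?g (Suc s + t))"
      unfolding M by (induction N) simp_all
    also have "(\<Sum>k<Suc s. ?g k) = ?g s" using below_s by simp
    also have "(\<Sum>t<N. ?g (Suc s + t)) = - x s * (\<Sum>t<N. y t * (A ^\<^sub>m Suc (s + t)) $$ (i, j))"
      unfolding sum_distrib_left y_def using s by (intro sum.cong) simp_all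
    finally have "x s * (A ^\<^sub>m s) $$ (i, j)
        = x s * (\<Sum>t<N. y t * (A ^\<^sub>m Suc (s + t)) $$ (i, j))"
      by (simp del: pow_mat.simps)
    then show ?thesis using s by (simp del: pow_mat.simps)
  qed
  show ?thesis
  proof (rule that[where s = s and N = N and y = y])
    fix k i j assume ij: "i < m" "j < m"
    \<comment> \<open>Multiply \<open>base\<close> from the right by \<open>A ^\<^sub>m k\<close>,
      entry by entry.\<close>
    have "(A ^\<^sub>m (s + k)) $$ (i, j) = (\<Sum>h<m. (A ^\<^sub>m s) $$ (i, h) * (A ^\<^sub>m k) $$ (h, j))"
      by (rule index_pow_mat_add[OF A ij])
    also have "\<dots> = (\<Sum>h<m. \<Sum>t<N. y t * ((A ^\<^sub>m Suc (s + t)) $$ (i, h) * (A ^\<^sub>m k) $$ (h, j)))"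
      using base ij(1) by (intro sum.cong) (auto simp: sum_distrib_right mult.assoc simp del: pow_mat.simps)
    also have "\<dots> = (\<Sum>t<N. y t * (\<Sum>h<m. (A ^\<^sub>m Suc (s + t)) $$ (i, h) * (A ^\<^sub>m k) $$ (h, j)))"
      by (subst sum.swap) (simp only: sum_distrib_left)
    also have "\<dots> = (\<Sum>t<N. y t * (A ^\<^sub>m (Suc (s + t) + k)) $$ (i, j))"
      by (simp only: index_pow_mat_add[OF A ij])
    finally show "(A ^\<^sub>m (s + k)) $$ (i, j)
        = (\<Sum>t<N. y t * (A ^\<^sub>m (Suc (s + t) + k)) $$ (i, j))" .
  qed
qed

text \<open>The shift by one is harmless because \<open>A\<close> is invertible up to a nilpotent part:
  from some exponent on, every power of \<open>A\<close> is a fixed linear combination of higher powers.\<close>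

lemma summable_pow_mat_shift:
  fixes A :: "real mat"
  assumes A: "A \<in> carrier_mat m m"
    and sum: "mat_summable m (\<lambda>k. c k \<cdot>\<^sub>m A ^\<^sub>m k)"
    and ij: "i < m" "j < m"
  shows "summable (\<lambda>k. c (Suc k) * (A ^\<^sub>m k) $$ (i, j))"
proof -
  have sum0: "summable (\<lambda>k. c k * (A ^\<^sub>m k) $$ (i, j))" if "i < m" "j < m" for i j
    using sum that A unfolding mat_summable_def by simp
  \<comment> \<open>Multiplying the given series by the fixed matrix \<open>A ^\<^sub>m t\<close>
    keeps it convergent, so powers higher than the coefficient index are under control.\<close>
  have sumT: "summable (\<lambda>k. c k * (A ^\<^sub>m (k + t)) $$ (i, j))" for t
  proof -
    have "summable (\<lambda>k. \<Sum>h<m. c k * (A ^\<^sub>m k) $$ (i, h) * (A ^\<^sub>m t) $$ (h, j))"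
      using ij sum0 by (intro summable_sum summable_mult2) auto
    then show ?thesis
      by (simp only: index_pow_mat_add[OF A ij] sum_distrib_left mult.assoc)
  qed
  obtain y N s where y: "\<And>k i j. i < m \<Longrightarrow> j < m \<Longrightarrow>
     (A ^\<^sub>m (s + k)) $$ (i, j) = (\<Sum>t<N. y t * (A ^\<^sub>m (Suc (s + t) + k)) $$ (i, j))"
    by (rule pow_mat_eq_sum_higher_powers[OF A], rule that)
  \<comment> \<open>Each \<open>t\<close> contributes the tail of \<open>sumT\<close> from
    \<open>Suc s\<close> on. With \<open>c (Suc (k + s))\<close> as common factor, the combination
    collapses to the lower power \<open>k + s\<close>, which is the desired shift by one.\<close>
  have "summable (\<lambda>k. \<Sum>t<N. y t * (c (k + Suc s) * (A ^\<^sub>m (k + Suc s + t)) $$ (i, j)))"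
    using summable_ignore_initial_segment[OF sumT, of "Suc s"]
    by (intro summable_sum summable_mult) auto
  moreover have "(\<Sum>t<N. y t * (c (k + Suc s) * (A ^\<^sub>m (k + Suc s + t)) $$ (i, j)))
      = c (Suc (k + s)) * (A ^\<^sub>m (k + s)) $$ (i, j)" for k
    using y[OF ij, of k]
    by (simp add: sum_distrib_left ac_simps del: pow_mat.simps)
  ultimately have "summable (\<lambda>k. c (Suc (k + s)) * (A ^\<^sub>m (k + s)) $$ (i, j))" by simp
  then show ?thesis using summable_iff_shift[of "\<lambda>k. c (Suc k) * (A ^\<^sub>m k) $$ (i, j)" s] by simp
qed

section \<open>Weighted walk counts\<close>

text \<open>Every node after the first is the target of an edge and so lies below \<open>n\<close>.
  The start is unrestricted, hence the \<open>insert i\<close>.\<close>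

lemma finite_walks:
  assumes "E \<subseteq> {..<n} \<times> {..<n}"
  shows "finite (walks E k i j)"
proof (rule finite_subset)
  show "walks E k i j \<subseteq> {w. set w \<subseteq> insert i {..<n} \<and> length w = Suc k}"
  proof
    fix w assume w: "w \<in> walks E k i j"
    then have w_ne: "w \<noteq> []" by (auto simp: walks_def)
    have "w ! l \<in> insert i {..<n}" if "l < length w" for l
    proof (cases l)
      case 0
      then show ?thesis using w hd_conv_nth[OF w_ne] by (auto simp: walks_def)
    next
      case (Suc l')
      then have "(w ! l', w ! Suc l') \<in> E" using w that by (auto simp: walks_def)
      then show ?thesis using Suc assms by auto
    qed
    then show "w \<in> {w. set w \<subseteq> insert i {..<n} \<and> length w = Suc k}"
      using w by (auto simp: walks_def set_conv_nth)
  qed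
  show "finite {w. set w \<subseteq> insert i {..<n} \<and> length w = Suc k}"
    by (rule finite_lists_length_eq) simp
qed

lemma walks_Suc: "walks E (Suc k) i j = (\<Union>a\<in>{a. (i, a) \<in> E}. (#) i ` walks E k a j)"
proof (intro equalityI subsetI)
  fix w assume w: "w \<in> walks E (Suc k) i j"
  then obtain v where v: "w = i # v" "length v = Suc k"
    by (cases w) (auto simp: walks_def)
  then have ne: "v \<noteq> []" by auto
  have E: "((i # v) ! l, (i # v) ! Suc l) \<in> E" if "l < Suc k" for l
    using w v that by (auto simp: walks_def)
  have "(i, hd v) \<in> E" using E[of 0] ne by (simp add: hd_conv_nth)
  moreover have "(v ! l, v ! Suc l) \<in> E" if "l < k" for l
    using E[of "Suc l"] that by simp
  ultimately show "w \<in> (\<Union>a\<in>{a. (i, a) \<in> E}. (#) i ` walks E k a j)"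
    using w v ne by (auto simp: walks_def)
next
  fix w assume "w \<in> (\<Union>a\<in>{a. (i, a) \<in> E}. (#) i ` walks E k a j)"
  then obtain a v where v: "(i, a) \<in> E" "w = i # v" "v \<in> walks E k a j" by auto
  then have "v \<noteq> []" by (auto simp: walks_def)
  then show "w \<in> walks E (Suc k) i j"
    using v by (auto simp: walks_def hd_conv_nth nth_Cons split: nat.splits)
qed

lemma sum_walks_Suc:
  fixes g :: "nat list \<Rightarrow> real"
  assumes E: "E \<subseteq> {..<n} \<times> {..<n}"
  shows "(\<Sum>w\<in>walks E (Suc k) i j. g w)
    = (\<Sum>a | (i, a) \<in> E. \<Sum>w\<in>walks E k a j. g (i # w))"
proof -
  have fin: "finite {a. (i, a) \<in> E}"
    by (rule finite_subset[of _ "{..<n}"]) (use E in auto)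
  \<comment> \<open>The union over the second node \<open>a\<close> is disjoint, since
    \<open>a\<close> can be read off the walk.\<close>
  have "(\<Sum>w\<in>walks E (Suc k) i j. g w)
      = (\<Sum>a | (i, a) \<in> E. \<Sum>w\<in>(#) i ` walks E k a j. g w)"
    unfolding walks_Suc using fin finite_walks[OF E]
    by (intro sum.UNION_disjoint) (auto simp: walks_def)
  then show ?thesis by (simp add: sum.reindex)
qed

text \<open>The new index 0 compares \<open>i\<close> with the head of \<open>w\<close>; all other
  indices are those of \<open>a # w\<close> moved up by one.\<close>

lemma backtracks_Cons_Cons:
  assumes "w \<noteq> []"
  shows "backtracks (i # a # w) = backtracks (a # w) + (if hd w = i then 1 else 0)"
proof -
  let ?S = "\<lambda>w. {l. l + 2 < length w \<and> w ! l = w ! (l + 2)}"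
  have fin: "finite (?S w)" for w :: "nat list"
    by (rule finite_subset[of _ "{..<length w}"]) auto
  have "?S (i # a # w) = Suc ` ?S (a # w) \<union> (if hd w = i then {0} else {})" (is "?L = ?R")
  proof (rule Set.set_eqI)
    fix l
    show "l \<in> ?L \<longleftrightarrow> l \<in> ?R"
      using assms by (cases l) (auto simp: hd_conv_nth)
  qed
  moreover have "card ?R = card (?S (a # w)) + (if hd w = i then 1 else 0)"
    using fin[of "a # w"] by (subst card_Un_disjoint) (auto simp: card_image)
  ultimately show ?thesis unfolding backtracks_def by (simp only:)
qed

lemma backtracks_rev: "backtracks (rev w) = backtracks w"
proof -
  let ?S = "\<lambda>w. {l. l + 2 < length w \<and> w ! l = w ! (l + 2)}"
  \<comment> \<open>Positions \<open>l\<close> and \<open>l + 2\<close> of \<open>rev w\<close> are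
    positions \<open>length w - 1 - l\<close> and \<open>length w - 3 - l\<close> of
    \<open>w\<close>; the smaller one is the index of the backtrack in \<open>w\<close>.\<close>
  have "bij_betw (\<lambda>l. length w - 3 - l) (?S (rev w)) (?S w)"
    by (rule bij_betwI[where g = "\<lambda>l. length w - 3 - l"])
      (auto simp: rev_nth numeral_3_eq_3 numeral_2_eq_2 Suc_diff_Suc)
  then show ?thesis unfolding backtracks_def by (rule bij_betw_same_card)
qed

lemma rev_walks:
  assumes "sym E" and w: "w \<in> walks E k i j"
  shows "rev w \<in> walks E k j i"
proof -
  have len: "length w = Suc k" and ne: "w \<noteq> []" using w by (auto simp: walks_def)
  have "(rev w ! l, rev w ! Suc l) \<in> E" if l: "l < k" for l
  proof -
    have "(w ! (k - Suc l), w ! Suc (k - Suc l)) \<in> E" using w l by (simp add: walks_def)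
    from symD[OF assms(1) this] show ?thesis using l len by (simp add: rev_nth Suc_diff_Suc)
  qed
  then show ?thesis using w ne by (simp add: walks_def hd_rev last_rev)
qed

text \<open>The entries of q_k as a function on all pairs of nodes, which spares range conditions
  when summing over neighbours.\<close>

definition walk_weight :: "(nat \<times> nat) set \<Rightarrow> real \<Rightarrow> nat \<Rightarrow> nat \<Rightarrow> nat \<Rightarrow> real" where
  "walk_weight E \<mu> k i j = (\<Sum>w\<in>walks E k i j. (1 - \<mu>) ^ backtracks w)"

lemma index_bd_walk_mat:
  "i < n \<Longrightarrow> j < n \<Longrightarrow> bd_walk_mat n E \<mu> k $$ (i, j) = walk_weight E \<mu> k i j"
  by (simp add: bd_walk_mat_def walk_weight_def)

lemma walk_weight_sym:
  assumes "sym E"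
  shows "walk_weight E \<mu> k i j = walk_weight E \<mu> k j i"
  unfolding walk_weight_def
  by (rule sum.reindex_bij_witness[where i = rev and j = rev])
    (auto simp: backtracks_rev intro: rev_walks[OF assms])

text \<open>Let \<open>q\<^sub>k(a)\<close> be the weight of the walks of length \<open>k\<close> from \<open>a\<close> to \<open>j\<close>, and \<open>T\<^sub>k(i, a)\<close> that of
  those walks preceded by the step \<open>i \<rightarrow> a\<close>. A second step back to \<open>i\<close> costs a factor \<open>1 - \<mu>\<close>, so
  \<open>T\<^sub>k(i, a) = q\<^sub>k(a) - \<mu> T\<^bsub>k-1\<^esub>(a, i)\<close>; apply this twice and sum over \<open>a\<close>.\<close>

lemma walk_weight_recurrence:
  assumes G: "simple_graph n E"
  shows "walk_weight E \<mu> (k + 3) i j =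
    (\<Sum>a | (i, a) \<in> E. walk_weight E \<mu> (k + 2) a j)
      + \<mu> * (\<mu> - real (card {a. (i, a) \<in> E})) * walk_weight E \<mu> (k + 1) i j"
proof -
  let ?N = "\<lambda>i. {a. (i, a) \<in> E}"
  have E: "E \<subseteq> {..<n} \<times> {..<n}" and symE: "sym E" using G by (auto simp: simple_graph_def)
  have fin: "finite (?N i)" for i
    by (rule finite_subset[of _ "{..<n}"]) (use E in auto)
  define T where "T k i a = (\<Sum>w\<in>walks E k a j. (1 - \<mu>) ^ backtracks (i # w))" for k i a
  have Q: "walk_weight E \<mu> (Suc k) i j = (\<Sum>a\<in>?N i. T k i a)" for k i
    unfolding walk_weight_def T_def by (rule sum_walks_Suc[OF E])
  have T: "T (Suc k) i a = walk_weight E \<mu> (Suc k) a j - \<mu> * T k a i" if ia: "i \<in> ?N a" for k i a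
  proof -
    have "T (Suc k) i a = (\<Sum>b\<in>?N a. \<Sum>w\<in>walks E k b j. (1 - \<mu>) ^ backtracks (i # a # w))"
      unfolding T_def by (rule sum_walks_Suc[OF E])
    \<comment> \<open>Only the second step \<open>b = i\<close> is a backtrack at the front; its
      factor \<open>1 - \<mu>\<close> is split into 1 and the correction
      \<open>- \<mu>\<close>.\<close>
    also have "\<dots> = (\<Sum>b\<in>?N a. T k a b - (if b = i then \<mu> * T k a b else 0))"
    proof (intro sum.cong refl)
      fix b
      have "(1 - \<mu>) ^ backtracks (i # a # w)
          = (if b = i then 1 - \<mu> else 1) * (1 - \<mu>) ^ backtracks (a # w)"
        if "w \<in> walks E k b j" for w
      proof -
        have "w \<noteq> []" "hd w = b" using that by (auto simp: walks_def)
        then show ?thesis by (simp add: backtracks_Cons_Cons)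
      qed
      then have "(\<Sum>w\<in>walks E k b j. (1 - \<mu>) ^ backtracks (i # a # w))
          = (if b = i then 1 - \<mu> else 1) * T k a b"
        by (simp add: T_def sum_distrib_left)
      then show "(\<Sum>w\<in>walks E k b j. (1 - \<mu>) ^ backtracks (i # a # w))
          = T k a b - (if b = i then \<mu> * T k a b else 0)"
        by (simp add: algebra_simps)
    qed
    also have "\<dots> = walk_weight E \<mu> (Suc k) a j - \<mu> * T k a i"
      using ia fin by (simp add: sum_subtractf Q)
    finally show ?thesis .
  qed
  have "walk_weight E \<mu> (k + 3) i j = (\<Sum>a\<in>?N i. T (k + 2) i a)"
    using Q[of "k + 2"] by (simp add: numeral_3_eq_3)
  also have "\<dots> = (\<Sum>a\<in>?N i. walk_weight E \<mu> (k + 2) a j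
      - \<mu> * (walk_weight E \<mu> (k + 1) i j - \<mu> * T k i a))"
  proof (intro sum.cong refl)
    fix a assume "a \<in> ?N i"
    \<comment> \<open>Since edges are undirected, \<open>T\<close> applies to the step from
      \<open>i\<close> to \<open>a\<close> and then to the step from \<open>a\<close> to
      \<open>i\<close>.\<close>
    then have "i \<in> ?N a" "a \<in> ?N i" using symE by (auto dest: symD)
    then show "T (k + 2) i a = walk_weight E \<mu> (k + 2) a j
        - \<mu> * (walk_weight E \<mu> (k + 1) i j - \<mu> * T k i a)"
      using T[of i a "Suc k"] T[of a i k] by simp
  qed
  \<comment> \<open>The middle term does not depend on \<open>a\<close>, so the sum over neighbours
    produces the degree; the remaining sum of \<open>T k i a\<close> is again a walk weight at
    \<open>i\<close>.\<close>
  also have "\<dots> = (\<Sum>a\<in>?N i. walk_weight E \<mu> (k + 2) a j)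
      - \<mu> * real (card (?N i)) * walk_weight E \<mu> (k + 1) i j + \<mu>\<^sup>2 * (\<Sum>a\<in>?N i. T k i a)"
    by (simp add: sum_subtractf sum.distrib sum_distrib_left algebra_simps power2_eq_square)
  also have "(\<Sum>a\<in>?N i. T k i a) = walk_weight E \<mu> (k + 1) i j" using Q[of k] by simp
  finally show ?thesis by (simp add: algebra_simps power2_eq_square)
qed

section \<open>The block matrix\<close>

lemma adjacency_mat_mult_vec:
  assumes "E \<subseteq> {..<n} \<times> {..<n}" and "i < n" and v: "dim_vec v = n"
  shows "(adjacency_mat n E *\<^sub>v v) $ i = (\<Sum>a | (i, a) \<in> E. v $ a)"
proof -
  have "(adjacency_mat n E *\<^sub>v v) $ i = (\<Sum>a\<in>{0..<n}. if (i, a) \<in> E then v $ a else 0)"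
    using assms by (auto simp: adjacency_mat_def scalar_prod_def intro!: sum.cong)
  also have "\<dots> = (\<Sum>a\<in>{a\<in>{0..<n}. (i, a) \<in> E}. v $ a)"
    by (rule sum.inter_filter[symmetric]) simp
  also have "{a\<in>{0..<n}. (i, a) \<in> E} = {a. (i, a) \<in> E}"
    using assms(1) by auto
  finally show ?thesis .
qed

lemma index_degree_mat:
  assumes "E \<subseteq> {..<n} \<times> {..<n}" and "i < n" "j < n"
  shows "degree_mat n E $$ (i, j) = (if i = j then real (card {a. (i, a) \<in> E}) else 0)"
proof -
  have "(adjacency_mat n E *\<^sub>v ones n) $ i = (\<Sum>a | (i, a) \<in> E. ones n $ a)"
    using assms by (intro adjacency_mat_mult_vec) (auto simp: ones_def)
  also have "\<dots> = (\<Sum>a | (i, a) \<in> E. 1)"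
    using assms(1) by (intro sum.cong) (auto simp: ones_def)
  finally show ?thesis
    using assms by (auto simp: degree_mat_def diag_def mat_diag_def adjacency_mat_def)
qed

lemma bd_block_mat_carrier: "bd_block_mat n E \<mu> \<in> carrier_mat (2 * n) (2 * n)"
  unfolding bd_block_mat_def mult_2
  by (rule four_block_carrier_mat) (simp_all add: adjacency_mat_def)

text \<open>Column \<open>j\<close> of q_k. The recurrence acts on each column separately, so
  stacked vectors replace stacked matrices.\<close>

definition walk_weight_vec :: "nat \<Rightarrow> (nat \<times> nat) set \<Rightarrow> real \<Rightarrow> nat \<Rightarrow> nat \<Rightarrow> real vec" where
  "walk_weight_vec n E \<mu> j k = vec n (\<lambda>i. walk_weight E \<mu> k i j)"

text \<open>The upper block row copies, the lower one is the recurrence. The indices start at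
  \<open>k + 1\<close> because Z [q_0; q_1] would have the surplus \<mu>^2 I in its lower
  block.\<close>

lemma bd_block_mat_step:
  assumes G: "simple_graph n E"
  shows "bd_block_mat n E \<mu> *\<^sub>v
      (walk_weight_vec n E \<mu> j (k + 1) @\<^sub>v walk_weight_vec n E \<mu> j (k + 2))
    = walk_weight_vec n E \<mu> j (k + 2) @\<^sub>v walk_weight_vec n E \<mu> j (k + 3)"
proof -
  let ?W = "walk_weight_vec n E \<mu> j"
  let ?C = "\<mu> \<cdot>\<^sub>m (\<mu> \<cdot>\<^sub>m 1\<^sub>m n - degree_mat n E)"
  have E: "E \<subseteq> {..<n} \<times> {..<n}" using G by (simp add: simple_graph_def)
  have A: "adjacency_mat n E \<in> carrier_mat n n" by (simp add: adjacency_mat_def)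
  have D: "degree_mat n E \<in> carrier_mat n n"
    using A by (simp add: degree_mat_def diag_def mat_diag_def)
  have W: "?W k \<in> carrier_vec n" for k by (simp add: walk_weight_vec_def)
  have "?C *\<^sub>v ?W (k + 1) + adjacency_mat n E *\<^sub>v ?W (k + 2) = ?W (k + 3)"
  proof (rule eq_vecI)
    fix i assume "i < dim_vec (?W (k + 3))"
    then have i: "i < n" by (simp add: walk_weight_vec_def)
    let ?d = "real (card {a. (i, a) \<in> E})"
    have "(?C *\<^sub>v ?W (k + 1)) $ i = (\<Sum>l\<in>{0..<n}. ?C $$ (i, l) * walk_weight E \<mu> (k + 1) l j)"
      using D i by (auto simp: scalar_prod_def walk_weight_vec_def intro!: sum.cong)
    also have "\<dots> = (\<Sum>l\<in>{0..<n}. if l = i then \<mu> * (\<mu> - ?d) * walk_weight E \<mu> (k + 1) i j else 0)"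
      using D i by (intro sum.cong refl) (auto simp: index_degree_mat[OF E])
    also have "\<dots> = \<mu> * (\<mu> - ?d) * walk_weight E \<mu> (k + 1) i j" using i by simp
    finally have "(?C *\<^sub>v ?W (k + 1)) $ i = \<mu> * (\<mu> - ?d) * walk_weight E \<mu> (k + 1) i j" .
    moreover have "(adjacency_mat n E *\<^sub>v ?W (k + 2)) $ i
        = (\<Sum>a | (i, a) \<in> E. walk_weight E \<mu> (k + 2) a j)"
    proof -
      have "(adjacency_mat n E *\<^sub>v ?W (k + 2)) $ i = (\<Sum>a | (i, a) \<in> E. ?W (k + 2) $ a)"
        using E i by (intro adjacency_mat_mult_vec) (auto simp: walk_weight_vec_def)
      also have "\<dots> = (\<Sum>a | (i, a) \<in> E. walk_weight E \<mu> (k + 2) a j)"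
        using E by (intro sum.cong) (auto simp: walk_weight_vec_def)
      finally show ?thesis .
    qed
    ultimately show "(?C *\<^sub>v ?W (k + 1) + adjacency_mat n E *\<^sub>v ?W (k + 2)) $ i = ?W (k + 3) $ i"
      using i A walk_weight_recurrence[OF G, of \<mu> k i j]
      by (simp add: walk_weight_vec_def del: index_mult_mat_vec)
  qed (use A in \<open>simp add: walk_weight_vec_def\<close>)
  moreover have "0\<^sub>m n n *\<^sub>v ?W (k + 1) + 1\<^sub>m n *\<^sub>v ?W (k + 2) = ?W (k + 2)"
    by (intro eq_vecI) (auto simp: scalar_prod_def walk_weight_vec_def)
  ultimately show ?thesis
    unfolding bd_block_mat_def
    using A D W by (subst four_block_mat_mult_vec[of _ n n _ n _ n]) auto
qed

lemma bd_block_mat_pow: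
  assumes G: "simple_graph n E"
  shows "bd_block_mat n E \<mu> ^\<^sub>m k *\<^sub>v
      (walk_weight_vec n E \<mu> j (l + 1) @\<^sub>v walk_weight_vec n E \<mu> j (l + 2))
    = walk_weight_vec n E \<mu> j (l + k + 1) @\<^sub>v walk_weight_vec n E \<mu> j (l + k + 2)"
proof (induction k arbitrary: l)
  case 0
  have "bd_block_mat n E \<mu> ^\<^sub>m 0 = 1\<^sub>m (2 * n)" using bd_block_mat_carrier[of n E \<mu>] by simp
  then show ?case by (simp add: mult_2 walk_weight_vec_def del: pow_mat.simps)
next
  case (Suc k)
  let ?p = "\<lambda>l. walk_weight_vec n E \<mu> j (l + 1) @\<^sub>v walk_weight_vec n E \<mu> j (l + 2)"
  let ?Z = "bd_block_mat n E \<mu>"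
  have p: "?p l \<in> carrier_vec (2 * n)" by (simp add: walk_weight_vec_def mult_2 carrier_vecI)
  \<comment> \<open>The rightmost factor acts first and advances the starting index, so the
    induction hypothesis is needed at \<open>Suc l\<close>.\<close>
  have "?Z ^\<^sub>m Suc k *\<^sub>v ?p l = ?Z ^\<^sub>m k *\<^sub>v (?Z *\<^sub>v ?p l)"
    unfolding pow_mat.simps
    by (rule assoc_mult_mat_vec[OF pow_carrier_mat[OF bd_block_mat_carrier] bd_block_mat_carrier p])
  also have "?Z *\<^sub>v ?p l = ?p (Suc l)"
    using bd_block_mat_step[OF G, of \<mu> j l] by (simp add: numeral_3_eq_3)
  also have "?Z ^\<^sub>m k *\<^sub>v ?p (Suc l) = ?p (Suc l + k)" by (rule Suc.IH)
  finally show ?case by simp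
qed

lemma mat_summable_bd_walk_mat:
  assumes G: "simple_graph n E"
    and sum: "mat_summable (2 * n) (\<lambda>k. c k \<cdot>\<^sub>m bd_block_mat n E \<mu> ^\<^sub>m k)"
  shows "mat_summable n (\<lambda>k. c k \<cdot>\<^sub>m bd_walk_mat n E \<mu> k)"
  unfolding mat_summable_def
proof (intro allI impI)
  fix i j assume ij: "i < n" "j < n"
  let ?Z = "bd_block_mat n E \<mu>"
  define p where "p = walk_weight_vec n E \<mu> j 1 @\<^sub>v walk_weight_vec n E \<mu> j 2"
  have p: "dim_vec p = 2 * n" by (simp add: p_def walk_weight_vec_def)
  have Q: "walk_weight E \<mu> (Suc k) i j = (\<Sum>l<2 * n. (?Z ^\<^sub>m k) $$ (i, l) * p $ l)" for k
  proof -
    \<comment> \<open>As \<open>i < n\<close>, row \<open>i\<close> lies in the upper block, which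
      holds q_{k+1}.\<close>
    have "walk_weight E \<mu> (Suc k) i j = (?Z ^\<^sub>m k *\<^sub>v p) $ i"
      using bd_block_mat_pow[OF G, of \<mu> k j 0] ij by (simp add: p_def walk_weight_vec_def numeral_2_eq_2)
    also have "\<dots> = (\<Sum>l<2 * n. (?Z ^\<^sub>m k) $$ (i, l) * p $ l)"
      using carrier_matD[OF bd_block_mat_carrier[of n E \<mu>]] ij p
      by (simp add: scalar_prod_def atLeast0LessThan)
    finally show ?thesis .
  qed
  have "summable (\<lambda>k. \<Sum>l<2 * n. c (Suc k) * (?Z ^\<^sub>m k) $$ (i, l) * p $ l)"
    using ij by (intro summable_sum summable_mult2 summable_pow_mat_shift[OF bd_block_mat_carrier sum]) auto
  then have "summable (\<lambda>k. c (Suc k) * walk_weight E \<mu> (Suc k) i j)"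
    by (simp add: Q sum_distrib_left mult.assoc)
  \<comment> \<open>The term for \<open>k = 0\<close>, outside the range of the block recurrence,
    does not affect convergence.\<close>
  then have "summable (\<lambda>k. c k * walk_weight E \<mu> k i j)"
    using summable_Suc_iff[of "\<lambda>k. c k * walk_weight E \<mu> k i j"] by blast
  moreover have "(c k \<cdot>\<^sub>m bd_walk_mat n E \<mu> k) $$ (i, j) = c k * walk_weight E \<mu> k i j" for k
    using ij index_bd_walk_mat[OF ij, of E \<mu> k] by (simp add: bd_walk_mat_def)
  ultimately show "summable (\<lambda>k. (c k \<cdot>\<^sub>m bd_walk_mat n E \<mu> k) $$ (i, j))" by simp
qed

section \<open>The Laplacian of a matrix\<close>

text \<open>With these signs and zero row sums, each Gershgorin disc has its radius equal to its
  centre \<open>M $$ (i, i)\<close>, hence lies in the closed right half-plane.\<close>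

lemma M_matrix_of_zero_row_sums:
  assumes M: "M \<in> carrier_mat n n"
    and off: "\<And>i j. i < n \<Longrightarrow> j < n \<Longrightarrow> i \<noteq> j \<Longrightarrow> M $$ (i, j) \<le> 0"
    and rows: "\<And>i. i < n \<Longrightarrow> (\<Sum>j<n. M $$ (i, j)) = 0"
  shows "M_matrix M"
  unfolding M_matrix_def Z_matrix_def
proof (intro conjI allI impI)
  fix x assume "eigenvalue (map_mat complex_of_real M) x"
  then obtain v where v: "v \<in> carrier_vec n" "v \<noteq> 0\<^sub>v n"
    "map_mat complex_of_real M *\<^sub>v v = x \<cdot>\<^sub>v v"
    using M by (auto simp: eigenvalue_def eigenvector_def)
  obtain l where l: "l < n" "v $ l \<noteq> 0"
    using v(1,2) by (metis eq_vecI carrier_vecD index_zero_vec)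
  \<comment> \<open>Choose the row \<open>i\<close> in which the eigenvector has its largest
    modulus.\<close>
  let ?S = "(\<lambda>j. cmod (v $ j)) ` {..<n}"
  have "Max ?S \<in> ?S" using l(1) by (intro Max_in) auto
  then obtain i where "i < n" and Max: "Max ?S = cmod (v $ i)" by auto
  then have i: "i < n" "\<And>j. j < n \<Longrightarrow> cmod (v $ j) \<le> cmod (v $ i)"
    unfolding Max[symmetric] by (auto intro!: Max_ge)
  have pos: "0 < cmod (v $ i)" using i(2)[OF l(1)] l(2) by (meson less_le_trans zero_less_norm_iff)
  define m where "m = M $$ (i, i)"
  \<comment> \<open>The zero row sum turns the centre \<open>m\<close> into the radius.\<close>
  have m: "m = (\<Sum>j\<in>{..<n} - {i}. - M $$ (i, j))"
    using rows[OF i(1)] i(1) by (simp add: m_def sum.remove[of "{..<n}" i] sum_negf)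
  have "x * v $ i = (map_mat complex_of_real M *\<^sub>v v) $ i" using v i(1) by simp
  also have "\<dots> = (\<Sum>j<n. complex_of_real (M $$ (i, j)) * v $ j)"
    using M v(1) i(1) by (simp add: scalar_prod_def atLeast0LessThan)
  also have "\<dots> = complex_of_real m * v $ i + (\<Sum>j\<in>{..<n} - {i}. complex_of_real (M $$ (i, j)) * v $ j)"
    using i(1) by (simp add: m_def sum.remove[of "{..<n}" i])
  finally have "(x - complex_of_real m) * v $ i
      = (\<Sum>j\<in>{..<n} - {i}. complex_of_real (M $$ (i, j)) * v $ j)"
    by (simp add: algebra_simps)
  then have "cmod (x - complex_of_real m) * cmod (v $ i)
      = cmod (\<Sum>j\<in>{..<n} - {i}. complex_of_real (M $$ (i, j)) * v $ j)"
    by (metis norm_mult)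
  also have "\<dots> \<le> (\<Sum>j\<in>{..<n} - {i}. - M $$ (i, j) * cmod (v $ i))"
  proof (rule sum_norm_le)
    fix j assume j: "j \<in> {..<n} - {i}"
    then have "M $$ (i, j) \<le> 0" using off i(1) by auto
    then have "cmod (complex_of_real (M $$ (i, j)) * v $ j) = - M $$ (i, j) * cmod (v $ j)"
      by (simp add: norm_mult)
    also have "\<dots> \<le> - M $$ (i, j) * cmod (v $ i)"
      using i(2) j \<open>M $$ (i, j) \<le> 0\<close> by (intro mult_left_mono) auto
    finally show "cmod (complex_of_real (M $$ (i, j)) * v $ j) \<le> - M $$ (i, j) * cmod (v $ i)" .
  qed
  also have "\<dots> = m * cmod (v $ i)" by (simp add: m sum_distrib_right)
  finally have "cmod (x - complex_of_real m) \<le> m" using pos by simp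
  moreover have "\<bar>Re (x - complex_of_real m)\<bar> \<le> cmod (x - complex_of_real m)"
    by (rule abs_Re_le_cmod)
  ultimately show "0 \<le> Re x" by simp
qed (use M off in auto)

lemma index_diag_row_sums_minus:
  assumes P: "P \<in> carrier_mat n n" and "i < n" "j < n"
  shows "(diag (P *\<^sub>v ones n) - P) $$ (i, j)
    = (if i = j then \<Sum>l<n. P $$ (i, l) else 0) - P $$ (i, j)"
  using assms
  by (auto simp: diag_def mat_diag_def ones_def scalar_prod_def atLeast0LessThan)

lemma index_bd_phi:
  assumes "i < n" "j < n"
  shows "bd_phi n E \<mu> c $$ (i, j) = (\<Sum>k. c k * walk_weight E \<mu> k i j)"
proof -
  have "(c k \<cdot>\<^sub>m bd_walk_mat n E \<mu> k) $$ (i, j) = c k * walk_weight E \<mu> k i j" for k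
    using assms index_bd_walk_mat[OF assms, of E \<mu> k] by (simp add: bd_walk_mat_def)
  then show ?thesis using assms by (simp add: bd_phi_def mat_suminf_def)
qed

theorem proposition5:
  fixes n :: nat and E :: "(nat \<times> nat) set" and \<mu> :: real and c :: "nat \<Rightarrow> real"
  assumes "simple_graph n E" and "connected_graph n E"
    and "0 < \<mu>" and "\<mu> \<le> 1"
    and "\<forall>k\<ge>1. c (Suc k) \<le> c k"
    and "mat_summable (2 * n) (\<lambda>k. c k \<cdot>\<^sub>m (bd_block_mat n E \<mu> ^\<^sub>m k))"
    and "\<forall>s\<in>{0, 1}. defined_on_spectrum
           (power_series_fun (\<lambda>k. complex_of_real (c (s + k))))
           (map_mat complex_of_real (bd_block_mat n E \<mu>))"
  shows "mat_summable n (\<lambda>k. c k \<cdot>\<^sub>m bd_walk_mat n E \<mu> k)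
    \<and> transpose_mat (bd_laplacian n E \<mu> c) = bd_laplacian n E \<mu> c
    \<and> bd_laplacian n E \<mu> c *\<^sub>v ones n = 0\<^sub>v n
    \<and> ((\<forall>i<n. \<forall>j<n. 0 \<le> bd_phi n E \<mu> c $$ (i, j)) \<longrightarrow>
         M_matrix (bd_laplacian n E \<mu> c))"
proof (intro conjI impI)
  let ?P = "bd_phi n E \<mu> c" and ?L = "bd_laplacian n E \<mu> c"
  have symE: "sym E" using assms(1) by (simp add: simple_graph_def)
  have P: "?P \<in> carrier_mat n n" by (simp add: bd_phi_def mat_suminf_def)
  have L: "?L \<in> carrier_mat n n"
    using P by (simp add: bd_laplacian_def diag_def minus_carrier_mat)
  have ix: "?L $$ (i, j) = (if i = j then \<Sum>l<n. ?P $$ (i, l) else 0) - ?P $$ (i, j)"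
    if "i < n" "j < n" for i j
    unfolding bd_laplacian_def by (rule index_diag_row_sums_minus[OF P that])
  have rows: "(\<Sum>j<n. ?L $$ (i, j)) = 0" if "i < n" for i
    using that by (simp add: ix sum_subtractf)
  \<comment> \<open>\<open>bd_phi\<close> is built from the total operator \<open>suminf\<close>;
    this convergence makes it a genuine sum.\<close>
  show "mat_summable n (\<lambda>k. c k \<cdot>\<^sub>m bd_walk_mat n E \<mu> k)"
    using assms(1,6) by (rule mat_summable_bd_walk_mat)
  \<comment> \<open>The series for entries \<open>(i, j)\<close> and \<open>(j, i)\<close> agree
    term by term.\<close>
  show "transpose_mat ?L = ?L"
    by (rule eq_matI) (use L in \<open>auto simp: ix index_bd_phi walk_weight_sym[OF symE]\<close>)
  show "?L *\<^sub>v ones n = 0\<^sub>v n"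
  proof (rule eq_vecI)
    fix i assume "i < dim_vec (0\<^sub>v n)"
    then show "(?L *\<^sub>v ones n) $ i = 0\<^sub>v n $ i"
      using L rows by (simp add: scalar_prod_def ones_def atLeast0LessThan)
  qed (use L in simp)
  assume "\<forall>i<n. \<forall>j<n. 0 \<le> ?P $$ (i, j)"
  \<comment> \<open>Off the diagonal \<open>?L\<close> is the negative of \<open>?P\<close>, which
    gives the sign condition.\<close>
  then show "M_matrix ?L"
    by (intro M_matrix_of_zero_row_sums[OF L] rows) (auto simp: ix)
qed

end
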